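(* Let $\mathbb{K}\subset\mathbb{C}$ be a field, let $\mathbf{f}=(f_1,\dots,f_N)\in\mathbb{K}[x_1,\dots,x_n]^N$, and let $\xi\in\mathbb{C}^n$ be an isolated multiple root of $\mathbf{f}$. Let $r$ be the rank of the Jacobian matrix $J_{\mathbf{f}}(\xi)$ and let $c=n-r$. Assume the polynomials and variables are ordered so that the upper left $r\times r$ block $A(\mathbf{x})$ of $J_{\mathbf{f}}(\mathbf{x})$ has rank $r$ at $\mathbf{x}=\xi$, and let $\Lambda_1^{\mathbf{x}},\dots,\Lambda_c^{\mathbf{x}}$ be the formal inverse system of order $1$ at $\xi$ defined from this block. Then for all $i=1,\dots,c$ and all $j=1,\dots,N$, $$\Lambda_i^{\mathbf{x}}(f_j)=\begin{vmatrix}\partial_1 f_1&\cdots&\partial_r f_1&\partial_{r+i}f_1\\ \vdots&&\vdots&\vdots\\ \partial_1 f_r&\cdots&\partial_r f_r&\partial_{r+i}f_r\\ \partial_1 f_j&\cdots&\partial_r f_j&\partial_{r+i}f_j\end{vmatrix}.$$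
   Context: Here $\partial_j=\partial/\partial x_j$ and $J_{\mathbf{f}}(\mathbf{x})=[\partial_j f_i(\mathbf{x})]_{1\le i\le N,\,1\le j\le n}$. After reordering polynomials and variables, write $J_{\mathbf{f}}(\mathbf{x})=\begin{bmatrix}A(\mathbf{x})&B(\mathbf{x})\\ C(\mathbf{x})&D(\mathbf{x})\end{bmatrix}$ with $A(\mathbf{x})$ of size $r\times r$ and $r=\operatorname{rank}J_{\mathbf{f}}(\xi)=\operatorname{rank}A(\xi)$; $B(\mathbf{x})$ has size $r\times c$. The $c$ columns of $$\det(A(\mathbf{x}))\begin{bmatrix}-A^{-1}(\mathbf{x})B(\mathbf{x})\\ \mathrm{Id}\end{bmatrix}$$ (the identity matrix if $r=0$) have entries in $\mathbb{K}[\mathbf{x}]$. Denoting the $i$-th column by $(\lambda_{i,1}(\mathbf{x}),\dots,\lambda_{i,n}(\mathbf{x}))^t$, set $\Lambda_i^{\mathbf{x}}=\sum_{j=1}^n\lambda_{i,j}(\mathbf{x})\,\partial_j$ for $i=1,\dots,c$; the family $\{\Lambda_1^{\mathbf{x}},\dots,\Lambda_c^{\mathbf{x}}\}$ is the formal inverse system of order $1$ at $\xi$. *)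

theory Defs
  imports
    "HOL-Library.Poly_Mapping"
    "HOL-Algebra.Subrings"
    "HOL-Computational_Algebra.Polynomial_Factorial"
    "Jordan_Normal_Form.Determinant"
    "Jordan_Normal_Form.DL_Rank"
    "Jordan_Normal_Form.Gauss_Jordan_Elimination"
begin

text \<open>
  A monomial is its finitely supported exponent vector, a polynomial maps monomials to
  coefficients. Variables, equations, rows and columns are all numbered from 0.
\<close>

type_synonym mpoly = "(nat \<Rightarrow>\<^sub>0 nat) \<Rightarrow>\<^sub>0 complex"

definition polys :: "complex set \<Rightarrow> nat \<Rightarrow> mpoly set" where
  "polys K n = {p. \<forall>m\<in>Poly_Mapping.keys p.
     Poly_Mapping.keys m \<subseteq> {..<n} \<and> Poly_Mapping.lookup p m \<in> K}"

definition const :: "complex \<Rightarrow> mpoly" where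
  "const a = Poly_Mapping.single 0 a"

definition eval :: "complex vec \<Rightarrow> mpoly \<Rightarrow> complex" where
  "eval x p = (\<Sum>m\<in>Poly_Mapping.keys p.
     Poly_Mapping.lookup p m * (\<Prod>k\<in>Poly_Mapping.keys m. (x $ k) ^ Poly_Mapping.lookup m k))"

text \<open>
  The exponent subtraction is truncated, but it only truncates in terms whose coefficient
  \<open>of_nat (lookup m j)\<close> vanishes.
\<close>

definition partial :: "nat \<Rightarrow> mpoly \<Rightarrow> mpoly" where
  "partial j p = (\<Sum>m\<in>Poly_Mapping.keys p.
     Poly_Mapping.single (m - Poly_Mapping.single j 1)
       (of_nat (Poly_Mapping.lookup m j) * Poly_Mapping.lookup p m))"

definition jacobian :: "nat \<Rightarrow> nat \<Rightarrow> (nat \<Rightarrow> mpoly) \<Rightarrow> mpoly mat" where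
  "jacobian N n f = mat N n (\<lambda>(i, j). partial j (f i))"

abbreviation eval_mat :: "complex vec \<Rightarrow> mpoly mat \<Rightarrow> complex mat" where
  "eval_mat x M \<equiv> map_mat (eval x) M"

abbreviation mrank :: "complex mat \<Rightarrow> nat" where
  "mrank M \<equiv> vec_space.rank (dim_row M) M"

definition roots :: "nat \<Rightarrow> nat \<Rightarrow> (nat \<Rightarrow> mpoly) \<Rightarrow> complex vec set" where
  "roots N n f = {x \<in> carrier_vec n. \<forall>j<N. eval x (f j) = 0}"

text \<open>Isolation is expressed with the balls of the maximum norm on \<open>\<complex>\<^sup>n\<close>.\<close>

definition isolated_root :: "nat \<Rightarrow> nat \<Rightarrow> (nat \<Rightarrow> mpoly) \<Rightarrow> complex vec \<Rightarrow> bool" where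
  "isolated_root N n f \<xi> \<longleftrightarrow> \<xi> \<in> roots N n f \<and>
     (\<exists>\<epsilon>>0. \<forall>y\<in>roots N n f. (\<forall>k<n. cmod (y $ k - \<xi> $ k) < \<epsilon>) \<longrightarrow> y = \<xi>)"

definition ideal_of :: "nat \<Rightarrow> nat \<Rightarrow> (nat \<Rightarrow> mpoly) \<Rightarrow> mpoly set" where
  "ideal_of N n f = {\<Sum>j<N. h j * f j | h. \<forall>j<N. h j \<in> polys UNIV n}"

text \<open>
  The contraction to \<open>\<complex>[x]\<close> of the extension of the ideal \<open>(f)\<close> to the local ring at \<open>\<xi>\<close>;
  at an isolated root this is the primary component of \<open>(f)\<close> belonging to \<open>\<xi>\<close>.
\<close>

definition primary_component ::
    "nat \<Rightarrow> nat \<Rightarrow> (nat \<Rightarrow> mpoly) \<Rightarrow> complex vec \<Rightarrow> mpoly set" where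
  "primary_component N n f \<xi> =
     {p \<in> polys UNIV n. \<exists>g\<in>polys UNIV n. eval \<xi> g \<noteq> 0 \<and> g * p \<in> ideal_of N n f}"

text \<open>The classes of the elements of \<open>B\<close> form a basis of the vector space \<open>\<complex>[x]/Q\<close>.\<close>

definition quotient_basis :: "nat \<Rightarrow> mpoly set \<Rightarrow> mpoly set \<Rightarrow> bool" where
  "quotient_basis n Q B \<longleftrightarrow> B \<subseteq> polys UNIV n \<and> finite B \<and>
     (\<forall>p\<in>polys UNIV n. \<exists>!a. (\<forall>b. b \<notin> B \<longrightarrow> a b = 0) \<and> p - (\<Sum>b\<in>B. const (a b) * b) \<in> Q)"

text \<open>The dimension of \<open>\<complex>[x]/Q\<close>, which is finite when \<open>\<xi>\<close> is an isolated root.\<close>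

definition multiplicity_at :: "nat \<Rightarrow> nat \<Rightarrow> (nat \<Rightarrow> mpoly) \<Rightarrow> complex vec \<Rightarrow> nat" where
  "multiplicity_at N n f \<xi> =
     (THE \<mu>. \<exists>B. quotient_basis n (primary_component N n f \<xi>) B \<and> card B = \<mu>)"

definition isolated_multiple_root ::
    "nat \<Rightarrow> nat \<Rightarrow> (nat \<Rightarrow> mpoly) \<Rightarrow> complex vec \<Rightarrow> bool" where
  "isolated_multiple_root N n f \<xi> \<longleftrightarrow> isolated_root N n f \<xi> \<and> multiplicity_at N n f \<xi> > 1"

definition block_A :: "nat \<Rightarrow> nat \<Rightarrow> (nat \<Rightarrow> mpoly) \<Rightarrow> nat \<Rightarrow> mpoly mat" where
  "block_A N n f r = (case split_block (jacobian N n f) r r of (A, B, C, D) \<Rightarrow> A)"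

definition block_B :: "nat \<Rightarrow> nat \<Rightarrow> (nat \<Rightarrow> mpoly) \<Rightarrow> nat \<Rightarrow> mpoly mat" where
  "block_B N n f r = (case split_block (jacobian N n f) r r of (A, B, C, D) \<Rightarrow> B)"

text \<open>
  The matrix \<open>det A \<cdot> [- A\<^sup>-\<^sup>1 B; Id]\<close> over the field of rational functions. For \<open>r = 0\<close> the
  block \<open>A\<close> is the \<open>0 \<times> 0\<close> matrix, with determinant 1, and the result is the identity matrix.
\<close>

definition inverse_system_mat :: "nat \<Rightarrow> nat \<Rightarrow> (nat \<Rightarrow> mpoly) \<Rightarrow> nat \<Rightarrow> mpoly fract mat" where
  "inverse_system_mat N n f r =
     (let A = map_mat to_fract (block_A N n f r);
          B = map_mat to_fract (block_B N n f r)
      in det A \<cdot>\<^sub>m ((- (the (mat_inverse A)) * B) @\<^sub>r 1\<^sub>m (n - r)))"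

text \<open>
  The polynomial \<open>\<lambda>\<^sub>i\<^sub>,\<^sub>k\<close>: the entries of the above matrix are polynomials, as
  \<open>det A \<cdot> A\<^sup>-\<^sup>1\<close> is the adjugate of \<open>A\<close>.
\<close>

definition inverse_system_coeff ::
    "nat \<Rightarrow> nat \<Rightarrow> (nat \<Rightarrow> mpoly) \<Rightarrow> nat \<Rightarrow> nat \<Rightarrow> nat \<Rightarrow> mpoly" where
  "inverse_system_coeff N n f r i k =
     (THE p. to_fract p = inverse_system_mat N n f r $$ (k, i))"

definition inverse_system_op ::
    "nat \<Rightarrow> nat \<Rightarrow> (nat \<Rightarrow> mpoly) \<Rightarrow> nat \<Rightarrow> nat \<Rightarrow> mpoly \<Rightarrow> mpoly" where
  "inverse_system_op N n f r i p =
     (\<Sum>k<n. inverse_system_coeff N n f r i k * partial k p)"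

end

theory Submission
  imports Defs
begin

text \<open>
  Write \<open>A\<close> for the leading \<open>r \<times> r\<close> block of the Jacobian matrix and \<open>b\<close> for the column of the
  \<open>\<partial>\<^bsub>r+i\<^esub> f\<^sub>k\<close>, \<open>k < r\<close>. Both sides of the claim are the Schur complement of \<open>A\<close> in the
  bordered matrix, cleared of denominators. The coefficients of the operator \<open>\<Lambda>\<^sub>i\<close> form the
  vector \<open>v = (- adj A b, det A)\<close>, up to zero entries. It is annihilated by the
  first \<open>r\<close> rows of the bordered matrix \<open>M\<close>, and the last row sends it to \<open>\<Lambda>\<^sub>i(f\<^sub>j)\<close>. Replacing
  the last column of the identity matrix by \<open>v\<close> therefore gives a triangular matrix \<open>U\<close> with
  determinant \<open>det A\<close> such that \<open>M U\<close> is block triangular with determinant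
  \<open>det A \<Lambda>\<^sub>i(f\<^sub>j)\<close>, and \<open>det M = \<Lambda>\<^sub>i(f\<^sub>j)\<close> follows on cancelling \<open>det A\<close>. This is
  \<open>det_four_block_mat_adj\<close>.

  It remains to see that \<open>det A\<close> may be cancelled and that \<open>v\<close> is as described. Since \<open>A(\<xi>)\<close> has full rank and evaluation at \<open>\<xi>\<close> is
  a ring homomorphism (\<open>eval_mult\<close>), the polynomial \<open>det A\<close> is not zero; hence \<open>A\<close> is invertible
  over the rational functions, and \<open>det A \<cdot> A\<^sup>-\<^sup>1 = adj A\<close> there
  (\<open>mat_inverse_eq_adj\<close>). As the adjugate commutes with the embedding of the polynomials into
  the rational functions, this identifies the coefficients of \<open>\<Lambda>\<^sub>i\<close>
  (\<open>inverse_system_coeff_eq\<close>).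
\<close>

section \<open>Evaluation of polynomials is a ring homomorphism\<close>

definition monomial_value :: "complex vec \<Rightarrow> (nat \<Rightarrow>\<^sub>0 nat) \<Rightarrow> complex" where
  "monomial_value x m = (\<Prod>k\<in>Poly_Mapping.keys m. (x $ k) ^ Poly_Mapping.lookup m k)"

lemma monomial_value_superset:
  assumes "finite S" "Poly_Mapping.keys m \<subseteq> S"
  shows "monomial_value x m = (\<Prod>k\<in>S. (x $ k) ^ Poly_Mapping.lookup m k)"
  unfolding monomial_value_def using assms
  by (intro prod.mono_neutral_left) (auto simp: in_keys_iff)

lemma monomial_value_add: "monomial_value x (m + m') = monomial_value x m * monomial_value x m'"
proof -
  let ?S = "Poly_Mapping.keys m \<union> Poly_Mapping.keys m'"
  have "monomial_value x (m + m') = (\<Prod>k\<in>?S. (x $ k) ^ Poly_Mapping.lookup (m + m') k)"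
    by (intro monomial_value_superset Poly_Mapping.keys_add) simp
  then show ?thesis
    using monomial_value_superset[of ?S m x] monomial_value_superset[of ?S m' x]
    by (simp add: lookup_add power_add prod.distrib)
qed

lemma eval_zero: "eval x 0 = 0"
  by (simp add: eval_def)

lemma eval_single: "eval x (Poly_Mapping.single m a) = a * monomial_value x m"
  by (cases "a = 0") (simp_all add: eval_def monomial_value_def)

lemma eval_add: "eval x (p + q) = eval x p + eval x q"
  unfolding eval_def by (rule setsum_keys_plus_distrib) (simp_all add: distrib_right)

lemma eval_sum: "eval x (sum g I) = (\<Sum>i\<in>I. eval x (g i))"
  by (induction I rule: infinite_finite_induct) (simp_all add: eval_zero eval_add)

text \<open>Bilinearity reduces multiplicativity of the evaluation to products of two monomials.\<close>

lemma mpoly_eq_sum_monomials: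
  fixes p :: mpoly
  shows "p = (\<Sum>m\<in>Poly_Mapping.keys p. Poly_Mapping.single m (Poly_Mapping.lookup p m))"
proof (rule poly_mapping_eqI)
  fix k
  show "Poly_Mapping.lookup p k = Poly_Mapping.lookup
      (\<Sum>m\<in>Poly_Mapping.keys p. Poly_Mapping.single m (Poly_Mapping.lookup p m)) k"
    by (simp add: lookup_sum lookup_single when_def in_keys_iff)
qed

lemma eval_mult: "eval x (p * q) = eval x p * eval x q"
proof -
  have "eval x (p * q) = eval x
      ((\<Sum>m\<in>Poly_Mapping.keys p. Poly_Mapping.single m (Poly_Mapping.lookup p m)) *
       (\<Sum>m\<in>Poly_Mapping.keys q. Poly_Mapping.single m (Poly_Mapping.lookup q m)))"
    using mpoly_eq_sum_monomials[of p] mpoly_eq_sum_monomials[of q] by simp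
  also have "\<dots> = (\<Sum>m\<in>Poly_Mapping.keys p. Poly_Mapping.lookup p m * monomial_value x m) *
       (\<Sum>m\<in>Poly_Mapping.keys q. Poly_Mapping.lookup q m * monomial_value x m)"
    by (simp add: sum_product eval_sum eval_single mult_single monomial_value_add ac_simps)
  also have "\<dots> = eval x p * eval x q"
    by (simp add: eval_def monomial_value_def)
  finally show ?thesis .
qed

lemma eval_one: "eval x 1 = 1"
  using eval_single[of x 0 1] by (simp add: monomial_value_def)

interpretation eval_hom: comm_ring_hom "eval x"
  by unfold_locales (simp_all add: eval_zero eval_one eval_add eval_mult)

interpretation to_fract_hom: inj_comm_ring_hom "to_fract :: 'a::idom \<Rightarrow> 'a fract"
  by unfold_locales auto

section \<open>Bordered determinants, inverses and adjugates\<close>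

text \<open>
  Cramer's rule in the form of a Schur complement: the right-hand side is
  \<open>det A \<cdot> (d - c A\<^sup>-\<^sup>1 b)\<close> with \<open>det A \<cdot> A\<^sup>-\<^sup>1\<close> replaced by the adjugate, so that no division
  occurs. The minus sign stays on the vector \<open>adj A b\<close> because that vector is the upper part of
  a column of the inverse system.
\<close>

lemma det_four_block_mat_adj:
  fixes A :: "'a::idom mat"
  assumes A: "A \<in> carrier_mat n n" and b: "b \<in> carrier_mat n 1"
    and c: "c \<in> carrier_mat 1 n" and d: "d \<in> carrier_mat 1 1"
    and det: "det A \<noteq> 0"
  shows "det (four_block_mat A b c d) = (c * - (adj_mat A * b)) $$ (0, 0) + d $$ (0, 0) * det A"
proof -
  let ?M = "four_block_mat A b c d"
  let ?v = "- (adj_mat A * b)" and ?e = "det A \<cdot>\<^sub>m 1\<^sub>m 1"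
  let ?U = "four_block_mat (1\<^sub>m n) ?v (0\<^sub>m 1 n) ?e"
  note adj = adj_mat(1)[OF A]
  have v: "?v \<in> carrier_mat n 1" using adj b by simp
  have e: "?e \<in> carrier_mat 1 1" by simp
  \<comment> \<open>The last column of \<open>?U\<close> lies in the kernel of the first \<open>n\<close> rows of \<open>?M\<close>.\<close>
  have Av: "A * ?v + b * ?e = 0\<^sub>m n 1"
  proof -
    have "A * ?v = - (A * (adj_mat A * b))"
      using A adj b by simp
    also have "A * (adj_mat A * b) = det A \<cdot>\<^sub>m b"
      using b by (simp add: adj_mat(2)[OF A] mult_smult_assoc_mat[where nr = n and n = n and nc = 1]
        flip: assoc_mult_mat[OF A adj b])
    finally have "A * ?v = - (det A \<cdot>\<^sub>m b)" .
    moreover have "b * ?e = det A \<cdot>\<^sub>m b"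
      using b by (simp add: mult_smult_distrib[where nr = n and n = 1 and nc = 1])
    ultimately show ?thesis using b by (simp add: uminus_l_inv_mat[where nr = n and nc = 1])
  qed
  have "?M * ?U = four_block_mat (A * 1\<^sub>m n + b * 0\<^sub>m 1 n) (A * ?v + b * ?e)
      (c * 1\<^sub>m n + d * 0\<^sub>m 1 n) (c * ?v + d * ?e)"
    by (rule mult_four_block_mat[OF A b c d]) (use v e in auto)
  also have "\<dots> = four_block_mat A (0\<^sub>m n 1) c (c * ?v + d * ?e)"
    using A b c d Av by simp
  finally have MU: "?M * ?U = four_block_mat A (0\<^sub>m n 1) c (c * ?v + d * ?e)" .
  have "det ?M * det ?U = det (?M * ?U)"
    by (rule det_mult[symmetric, of _ "n + 1"]) (use A d v e in auto)
  also have "\<dots> = det A * det (c * ?v + d * ?e)"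
    unfolding MU by (rule det_four_block_mat_upper_right_zero[OF A refl c]) (use c d v in auto)
  also have "det ?U = det (1\<^sub>m n) * det ?e"
    by (rule det_four_block_mat_lower_left_zero[OF _ v refl e]) simp
  also have "det (c * ?v + d * ?e) = (c * ?v + d * ?e) $$ (0, 0)"
    by (rule det_single) (use c d v in auto)
  also have "\<dots> = (c * ?v) $$ (0, 0) + d $$ (0, 0) * det A"
    using c d v by simp
  finally show ?thesis using det by simp
qed

lemma mat_inverse_eq_adj:
  fixes A :: "'a::field mat"
  assumes A: "A \<in> carrier_mat n n" and det: "det A \<noteq> 0"
  shows "det A \<cdot>\<^sub>m the (mat_inverse A) = adj_mat A"
    and "the (mat_inverse A) \<in> carrier_mat n n"
proof -
  have "A \<in> Units (ring_mat TYPE('a) n ())"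
    using det_non_zero_imp_unit[OF A det] .
  then obtain B where B: "mat_inverse A = Some B"
    using mat_inverse(1)[OF A, where b = "()"] by (cases "mat_inverse A") auto
  from mat_inverse(2)[OF A B] have *: "B * A = 1\<^sub>m n" "B \<in> carrier_mat n n" by auto
  \<comment> \<open>Uniqueness of inverses: multiply \<open>A * adj_mat A = det A\<close> by \<open>B\<close> from the left.\<close>
  have "det A \<cdot>\<^sub>m B = B * (A * adj_mat A)"
    using * by (simp add: adj_mat(2)[OF A] mult_smult_distrib[where nr = n and n = n and nc = n])
  also have "\<dots> = adj_mat A"
    using * A adj_mat(1)[OF A] by (simp flip: assoc_mult_mat)
  finally show "det A \<cdot>\<^sub>m the (mat_inverse A) = adj_mat A" using B by simp
  show "the (mat_inverse A) \<in> carrier_mat n n" using * B by simp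
qed

lemma (in comm_ring_hom) hom_adj_mat:
  "A \<in> carrier_mat n n \<Longrightarrow> adj_mat (map_mat hom A) = map_mat hom (adj_mat A)"
  by (rule eq_matI) (auto simp: adj_mat_def cofactor_def mat_delete_def hom_distribs simp flip: hom_det
      intro!: arg_cong2[where f = "(*)"] arg_cong[where f = det])

section \<open>The coefficients of the inverse system\<close>

lemma block_carrier:
  "block_A N n f r \<in> carrier_mat r r" "block_B N n f r \<in> carrier_mat r (n - r)"
  by (simp_all add: block_A_def block_B_def split_block_def jacobian_def Let_def)

text \<open>
  The factor \<open>det A\<close> clears the denominators of \<open>A\<^sup>-\<^sup>1\<close>; the polynomial matrix exhibited here is
  the witness for the description of the coefficients of \<open>\<Lambda>\<^sub>i\<close> as polynomials.
\<close>

lemma inverse_system_mat_eq: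
  fixes f :: "nat \<Rightarrow> mpoly" and N n r :: nat
  defines "A \<equiv> block_A N n f r" and "B \<equiv> block_B N n f r"
  assumes det: "det A \<noteq> 0"
  shows "inverse_system_mat N n f r =
    map_mat to_fract (- (adj_mat A * B) @\<^sub>r det A \<cdot>\<^sub>m 1\<^sub>m (n - r))"
proof -
  let ?A = "map_mat to_fract A" and ?B = "map_mat to_fract B"
  have A: "A \<in> carrier_mat r r" and B: "B \<in> carrier_mat r (n - r)"
    by (simp_all add: A_def B_def block_carrier)
  have A': "?A \<in> carrier_mat r r" and B': "?B \<in> carrier_mat r (n - r)"
    using A B by simp_all
  have det': "det ?A \<noteq> 0" using det by simp
  let ?M = "the (mat_inverse ?A)"
  note inv = mat_inverse_eq_adj[OF A' det']
  have "det ?A \<cdot>\<^sub>m (- ?M * ?B) = - ((det ?A \<cdot>\<^sub>m ?M) * ?B)"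
    using inv(2) B' by (intro eq_matI) auto
  also have "\<dots> = map_mat to_fract (- (adj_mat A * B))"
    unfolding inv(1) to_fract_hom.hom_adj_mat[OF A]
      to_fract_hom.mat_hom_mult[OF adj_mat(1)[OF A] B, symmetric]
    by (intro eq_matI) auto
  finally have upper: "det ?A \<cdot>\<^sub>m (- ?M * ?B) = map_mat to_fract (- (adj_mat A * B))" .
  have "inverse_system_mat N n f r = det ?A \<cdot>\<^sub>m ((- ?M * ?B) @\<^sub>r 1\<^sub>m (n - r))"
    by (simp add: inverse_system_mat_def A_def B_def Let_def)
  also have "\<dots> = (det ?A \<cdot>\<^sub>m (- ?M * ?B)) @\<^sub>r (det ?A \<cdot>\<^sub>m 1\<^sub>m (n - r))"
    using inv(2) B' by (intro eq_matI) (auto simp: append_rows_def)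
  also have "\<dots> = map_mat to_fract (- (adj_mat A * B) @\<^sub>r det A \<cdot>\<^sub>m 1\<^sub>m (n - r))"
    unfolding upper using adj_mat(1)[OF A] B
    by (intro eq_matI) (auto simp: append_rows_def)
  finally show ?thesis .
qed

lemma inverse_system_coeff_eq:
  fixes f :: "nat \<Rightarrow> mpoly" and N n r :: nat
  defines "A \<equiv> block_A N n f r" and "B \<equiv> block_B N n f r"
  assumes det: "det A \<noteq> 0" and i: "i < n - r" and k: "k < n"
  shows "inverse_system_coeff N n f r i k =
    (if k < r then - (adj_mat A * B) $$ (k, i) else if k = r + i then det A else 0)"
proof -
  have A: "A \<in> carrier_mat r r" and B: "B \<in> carrier_mat r (n - r)"
    by (simp_all add: A_def B_def block_carrier)
  have "inverse_system_mat N n f r $$ (k, i) =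
      to_fract (if k < r then - (adj_mat A * B) $$ (k, i) else if k = r + i then det A else 0)"
    unfolding inverse_system_mat_eq[OF det[unfolded A_def]] A_def[symmetric] B_def[symmetric]
    using adj_mat(1)[OF A] B i k by (auto simp: append_rows_def)
  then show ?thesis
    by (simp add: inverse_system_coeff_def)
qed

section \<open>The operators applied to the equations\<close>

text \<open>
  For the Jacobian matrix this gives \<open>r \<le> N\<close>, so the leading block \<open>A\<close> consists of
  genuine entries of the matrix, that is, of derivatives of \<open>f\<^sub>0, \<dots>, f\<^bsub>r-1\<^esub>\<close>.
\<close>

lemma (in vec_space) rank_le_nr:
  assumes A: "A \<in> carrier_mat n nc"
  shows "rank A \<le> n"
proof -
  obtain S where S: "maximal S (\<lambda>T. T \<subseteq> set (cols A) \<and> lin_indpt T)"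
    using maximal_exists[of "(\<lambda>T. T \<subseteq> set (cols A) \<and> lin_indpt T)" "card (set (cols A))" "{}"]
    by (meson List.finite_set card_mono empty_iff empty_subsetI finite_lin_indpt2 rev_finite_subset)
  then have "S \<subseteq> set (cols A)" "lin_indpt S" by (simp_all add: maximal_def)
  then have "card S \<le> dim"
    using cols_dim[of A] A by (intro li_le_dim(2)) auto
  then show ?thesis
    using rank_card_indpt[OF A S] dim_is_n by simp
qed

theorem proposition3p2:
  fixes K :: "complex set" and N n r c :: nat
    and f :: "nat \<Rightarrow> mpoly" and \<xi> :: "complex vec"
  assumes "subfield K (class_ring :: complex ring)"
    and "\<And>j. j < N \<Longrightarrow> f j \<in> polys K n"
    and "isolated_multiple_root N n f \<xi>"
    and "r = mrank (eval_mat \<xi> (jacobian N n f))"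
    and "c = n - r"
    and "mrank (eval_mat \<xi> (block_A N n f r)) = r"
  shows "\<forall>i<c. \<forall>j<N.
    inverse_system_op N n f r i (f j) =
    det (mat (r + 1) (r + 1) (\<lambda>(k, l).
      partial (if l < r then l else r + i) (f (if k < r then k else j))))"
proof (intro allI impI)
  fix i j assume "i < c" and "j < N"
  then have i: "i < n - r" using assms(5) by simp
  have rN: "r \<le> N"
    unfolding assms(4) using vec_space.rank_le_nr[of "eval_mat \<xi> (jacobian N n f)" N n]
    by (simp add: jacobian_def)
  define A where "A = block_A N n f r"
  define B where "B = block_B N n f r"
  have A: "A \<in> carrier_mat r r" and B: "B \<in> carrier_mat r (n - r)"
    by (simp_all add: A_def B_def block_carrier)
  have "det (eval_mat \<xi> A) \<noteq> 0"
    using vec_space.det_rank_iff[of "eval_mat \<xi> A" r] A assms(6) by (simp add: A_def)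
  then have det: "det A \<noteq> 0" by (auto simp: eval_zero)
  define b where "b = mat r 1 (\<lambda>(k, l). partial (r + i) (f k))"
  define row where "row = mat 1 r (\<lambda>(k, l). partial l (f j))"
  define d where "d = mat 1 1 (\<lambda>(k, l). partial (r + i) (f j))"
  have b: "b \<in> carrier_mat r 1" and row: "row \<in> carrier_mat 1 r" and d: "d \<in> carrier_mat 1 1"
    by (simp_all add: b_def row_def d_def)
  have bordered: "mat (r + 1) (r + 1) (\<lambda>(k, l).
      partial (if l < r then l else r + i) (f (if k < r then k else j))) = four_block_mat A b row d"
    using i rN by (intro eq_matI)
      (auto simp: A_def b_def row_def d_def block_A_def split_block_def jacobian_def Let_def)
  have col: "col B i = col b 0"
    using i rN by (intro eq_vecI)
      (auto simp: B_def b_def block_B_def split_block_def jacobian_def Let_def add.commute)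
  let ?coeff = "inverse_system_coeff N n f r i"
  note coeff = inverse_system_coeff_eq[OF det[unfolded A_def] i, folded A_def B_def]
  have "inverse_system_op N n f r i (f j) =
      (\<Sum>k<r. ?coeff k * partial k (f j)) + (\<Sum>k=r..<n. ?coeff k * partial k (f j))"
    using i sum.atLeastLessThan_concat[of 0 r n "\<lambda>k. ?coeff k * partial k (f j)"]
    by (simp add: inverse_system_op_def lessThan_atLeast0)
  also have "(\<Sum>k<r. ?coeff k * partial k (f j)) = (row * - (adj_mat A * b)) $$ (0, 0)"
  proof -
    have "(\<Sum>k<r. ?coeff k * partial k (f j)) =
        (\<Sum>k<r. partial k (f j) * - (adj_mat A * b) $$ (k, 0))"
      using i A B b adj_mat(1)[OF A] by (intro sum.cong) (simp_all add: coeff col)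
    then show ?thesis
      using b adj_mat(1)[OF A]
      by (simp add: row_def scalar_prod_def lessThan_atLeast0 sum_negf)
  qed
  also have "(\<Sum>k=r..<n. ?coeff k * partial k (f j)) =
      (\<Sum>k=r..<n. if k = r + i then det A * partial k (f j) else 0)"
    by (intro sum.cong) (auto simp: coeff)
  also have "\<dots> = d $$ (0, 0) * det A"
    using i by (simp add: d_def)
  finally show "inverse_system_op N n f r i (f j) = det (mat (r + 1) (r + 1) (\<lambda>(k, l).
      partial (if l < r then l else r + i) (f (if k < r then k else j))))"
    unfolding bordered det_four_block_mat_adj[OF A b row d det] .
qed

end
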